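(* Let $N\ge 2$, $p>1$, $i\in\{1,\dots,N-1\}$, and let $C\in\mathbb{R}$ be any constant. Let $\Omega\subset\mathbb{R}^N$ be an open set satisfying the interior sphere condition at some point $x_0\in\partial\Omega$ (i.e. there is an open ball $B_R(y_0)\subset\Omega$, $R>0$, with $x_0\in\partial B_R(y_0)$). Then there exists no viscosity subsolution $u\in \mathrm{USC}(\Omega)$ of $$-\lambda_i(D^2u)+|Du|^p=C\quad\text{in }\Omega$$ satisfying $\displaystyle\lim_{x\to x_0,\ x\in\Omega}u(x)=+\infty$.
   Context: For a real symmetric $N\times N$ matrix $X$, $\lambda_1(X)\le\dots\le\lambda_N(X)$ denote its eigenvalues in nondecreasing order. $\mathrm{USC}(\Omega)$ is the set of real-valued upper semicontinuous functions on $\Omega$. A function $u\in\mathrm{USC}(\Omega)$ is a viscosity subsolution of $-\lambda_i(D^2u)+|Du|^p=C$ in $\Omega$ if, whenever $\varphi$ is $C^2$ and $u-\varphi$ has a local maximum at $x\in\Omega$, one has $-\lambda_i(D^2\varphi(x))+|D\varphi(x)|^p\le C$. *)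

theory Defs
  imports "HOL-Analysis.Analysis"
begin

definition eigenspace :: "real^'n^'n \<Rightarrow> real \<Rightarrow> (real^'n) set" where
  "eigenspace A c = {v. A *v v = c *\<^sub>R v}"

definition spectrum :: "real^'n^'n \<Rightarrow> real set" where
  "spectrum A = {c. \<exists>v. v \<noteq> 0 \<and> v \<in> eigenspace A c}"

(* Each eigenvalue is repeated according to the dimension of its eigenspace. For a symmetric
   matrix this is also its algebraic multiplicity, so the list has length CARD('n). *)
definition eigenvalue_list :: "real^'n^'n \<Rightarrow> real list" where
  "eigenvalue_list A =
     concat (map (\<lambda>c. replicate (dim (eigenspace A c)) c) (sorted_list_of_set (spectrum A)))"

(* The eigenvalues are numbered from 1, the entries of a list from 0. Meant for symmetric A
   and 1 \<le> i \<le> CARD('n). *)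
definition eigenvalue_nth :: "nat \<Rightarrow> real^'n^'n \<Rightarrow> real" where
  "eigenvalue_nth i A = eigenvalue_list A ! (i - 1)"

definition gradient :: "(real^'n \<Rightarrow> real) \<Rightarrow> real^'n \<Rightarrow> real^'n" where
  "gradient f x = (\<chi> k. frechet_derivative f (at x) (axis k 1))"

definition hessian :: "(real^'n \<Rightarrow> real) \<Rightarrow> real^'n \<Rightarrow> real^'n^'n" where
  "hessian f x = jacobian (gradient f) (at x)"

(* Meant for open sets: differentiability is the two-sided one, at x rather than within \<Omega>. *)
definition C2_on :: "(real^'n) set \<Rightarrow> (real^'n \<Rightarrow> real) \<Rightarrow> bool" where
  "C2_on \<Omega> f \<longleftrightarrow>
     (\<forall>x\<in>\<Omega>. f differentiable (at x)) \<and>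
     (\<forall>x\<in>\<Omega>. gradient f differentiable (at x)) \<and>
     continuous_on \<Omega> (hessian f)"

definition USC :: "'a::topological_space set \<Rightarrow> ('a \<Rightarrow> real) set" where
  "USC \<Omega> = {u. \<forall>x\<in>\<Omega>. \<forall>c > u x. eventually (\<lambda>y. u y < c) (at x within \<Omega>)}"

definition local_max_on :: "'a::topological_space set \<Rightarrow> ('a \<Rightarrow> real) \<Rightarrow> 'a \<Rightarrow> bool" where
  "local_max_on \<Omega> f x \<longleftrightarrow> x \<in> \<Omega> \<and> eventually (\<lambda>y. f y \<le> f x) (at x within \<Omega>)"

(* Viscosity subsolutions of -\<lambda>_i(D^2 u) + |Du|^p = C in \<Omega>. *)
definition viscosity_subsolution ::
    "nat \<Rightarrow> real \<Rightarrow> real \<Rightarrow> (real^'n) set \<Rightarrow> (real^'n \<Rightarrow> real) \<Rightarrow> bool" where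
  "viscosity_subsolution i p C \<Omega> u \<longleftrightarrow>
     u \<in> USC \<Omega> \<and>
     (\<forall>\<phi> x. C2_on \<Omega> \<phi> \<and> local_max_on \<Omega> (\<lambda>y. u y - \<phi> y) x \<longrightarrow>
        - eigenvalue_nth i (hessian \<phi> x) + norm (gradient \<phi> x) powr p \<le> C)"

definition interior_sphere_condition :: "(real^'n) set \<Rightarrow> real^'n \<Rightarrow> bool" where
  "interior_sphere_condition \<Omega> x0 \<longleftrightarrow>
     x0 \<in> frontier \<Omega> \<and>
     (\<exists>y0 R. R > 0 \<and> ball y0 R \<subseteq> \<Omega> \<and> x0 \<in> frontier (ball y0 R))"

end

theory Submission
  imports Defs "HOL-Real_Asymp.Real_Asymp"
begin

text \<open>
  Blow-up is ruled out by a uniform upper bound for \<open>u\<close> on the interior ball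
  \<open>ball y0 R\<close>, obtained by comparison with radial barriers.

  A radial function \<open>x \<mapsto> h (\<bar>x - y0\<bar>\<^sup>2)\<close> with \<open>h\<close> increasing and convex has the Hessian eigenvalue
  \<open>2 h'\<close> on the hyperplane orthogonal to \<open>x - y0\<close> and a larger one in the radial direction. As
  \<open>i < N\<close>, the operator \<open>\<lambda>\<^sub>i\<close> only sees \<open>2 h'\<close>: convexity in the radial direction, however large,
  costs nothing. The gradient has length \<open>2 h' r\<close> with \<open>r = \<bar>x - y0\<bar>\<close>. Since \<open>p > 1\<close>, the
  inequality \<open>2 h' < (2 h' r)\<^sup>p - C\<close> holds for all \<open>r \<ge> R/2\<close> as soon as \<open>h'\<close> exceeds a constant
  depending only on \<open>p\<close>, \<open>C\<close> and \<open>R\<close>. Such a function cannot touch \<open>u\<close> from above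
  on the annulus \<open>r > R/2\<close>.

  It therefore suffices to have convex \<open>h\<close> with \<open>h' \<ge> K\<close> that dominate \<open>u\<close> on the two boundary
  spheres \<open>r = R/2\<close> and \<open>r = \<rho> < R\<close>. The choice
  \<open>h s = M + K (s - (R/2)\<^sup>2) + a exp (L (s - \<rho>\<^sup>2))\<close> does this when \<open>M \<ge> 0\<close> bounds \<open>u\<close> on the inner
  ball and \<open>a\<close> bounds \<open>u\<close> on the closed ball of radius \<open>\<rho>\<close>. Nothing is known about how \<open>a\<close> grows
  as \<open>\<rho>\<close> approaches \<open>R\<close>, but letting \<open>L\<close> tend to infinity with \<open>\<rho>\<close> fixed removes the exponential
  at all points with \<open>r < \<rho>\<close>. What remains is \<open>u \<le> M + K R\<^sup>2\<close> on the whole ball. The exponential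
  also makes the barrier smooth on the whole space, as the definition of a subsolution demands of
  its test functions.
\<close>

section \<open>Upper semicontinuous functions on compact sets\<close>

text \<open>If no point were a maximum, the sublevel sets \<open>{y. u y < u z}\<close>, \<open>z \<in> S\<close>, would cover \<open>S\<close>; the
  largest of the finitely many levels in a subcover would then exceed its own value.\<close>

lemma USC_attains_sup:
  assumes u: "u \<in> USC S" and S: "compact S" "S \<noteq> {}"
  shows "\<exists>x\<in>S. \<forall>y\<in>S. u y \<le> u x"
proof (rule ccontr)
  assume "\<not> ?thesis"
  then have above: "\<exists>z\<in>S. u x < u z" if "x \<in> S" for x
    using that by (auto simp: not_le)
  have "\<exists>T z. open T \<and> x \<in> T \<and> z \<in> S \<and> (\<forall>y\<in>T \<inter> S. u y < u z)" if x: "x \<in> S" for x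
  proof -
    obtain z where z: "z \<in> S" "u x < u z"
      using above[OF x] by blast
    then have "eventually (\<lambda>y. u y < u z) (at x within S)"
      using u x by (auto simp: USC_def)
    then obtain T where "open T" "x \<in> T" "\<forall>y\<in>T. y \<noteq> x \<longrightarrow> y \<in> S \<longrightarrow> u y < u z"
      by (auto simp: eventually_at_topological)
    then show ?thesis
      by (intro exI[of _ T] exI[of _ z]) (use z in auto)
  qed
  then obtain T z where T: "\<And>x. x \<in> S \<Longrightarrow> open (T x) \<and> x \<in> T x \<and> z x \<in> S \<and>
      (\<forall>y\<in>T x \<inter> S. u y < u (z x))"
    by metis
  obtain F where F: "F \<subseteq> S" "finite F" "S \<subseteq> (\<Union>x\<in>F. T x)"
    by (rule compactE_image[OF S(1), of S T]) (use T in auto)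
  have "F \<noteq> {}"
    using F S by auto
  then have "Max ((\<lambda>x. u (z x)) ` F) \<in> (\<lambda>x. u (z x)) ` F"
    using F(2) by (intro Max_in) auto
  then obtain m where m: "m \<in> F" "Max ((\<lambda>x. u (z x)) ` F) = u (z m)"
    by blast
  have "z m \<in> S"
    using m(1) F(1) T by blast
  then obtain x where "x \<in> F" "z m \<in> T x"
    using F(3) by blast
  then have "u (z m) < u (z x)"
    using T F(1) \<open>z m \<in> S\<close> by blast
  then show False
    using Max_ge[of "(\<lambda>x. u (z x)) ` F" "u (z x)"] F(2) \<open>x \<in> F\<close> m(2) by simp
qed

lemma USC_subset: "u \<in> USC \<Omega> \<Longrightarrow> S \<subseteq> \<Omega> \<Longrightarrow> u \<in> USC S"
  unfolding USC_def by (auto intro: filter_leD[OF at_le])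

lemma USC_bounded_above:
  assumes "u \<in> USC S" "compact S"
  shows "\<exists>B. \<forall>x\<in>S. u x \<le> B"
  using USC_attains_sup[OF assms] by (cases "S = {}") auto

lemma USC_diff_continuous:
  assumes u: "u \<in> USC S" and f: "continuous_on S f"
  shows "(\<lambda>x. u x - f x) \<in> USC S"
  unfolding USC_def
proof (safe)
  fix x c assume x: "x \<in> S" and c: "u x - f x < c"
  define e where "e = (c - (u x - f x)) / 2"
  have e: "e > 0"
    using c by (simp add: e_def)
  have "eventually (\<lambda>y. u y < u x + e) (at x within S)"
    using u x e by (auto simp: USC_def)
  moreover have "eventually (\<lambda>y. f x - e < f y) (at x within S)"
    using f x e by (intro order_tendstoD(1)[where y = "f x"]) (auto simp: continuous_on)
  ultimately show "eventually (\<lambda>y. u y - f y < c) (at x within S)"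
    by eventually_elim (simp add: e_def field_simps)
qed

section \<open>Eigenvalues of a rank-one perturbation of a multiple of the identity\<close>

text \<open>The hyperplane orthogonal to \<open>v\<close> is the eigenspace of \<open>\<alpha>\<close>, and the remaining eigenvalue
  \<open>\<alpha> + \<beta> \<bar>v\<bar>\<^sup>2\<close> is larger, so the sorted list begins with \<open>CARD('n) - 1\<close> copies of \<open>\<alpha>\<close>.\<close>

lemma eigenvalue_nth_rank_one_perturbation:
  fixes A :: "real^'n^'n" and v :: "real^'n"
  assumes A: "\<And>w. A *v w = \<alpha> *\<^sub>R w + (\<beta> * (v \<bullet> w)) *\<^sub>R v"
    and v: "v \<noteq> 0" and \<beta>: "\<beta> > 0" and N: "CARD('n) \<ge> 2" and i: "i \<in> {1..CARD('n) - 1}"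
  shows "eigenvalue_nth i A = \<alpha>"
proof -
  define \<gamma> where "\<gamma> = \<alpha> + \<beta> * (v \<bullet> v)"
  have \<gamma>: "\<alpha> < \<gamma>"
    using v \<beta> by (simp add: \<gamma>_def)
  have hyperplane: "eigenspace A \<alpha> = {w. v \<bullet> w = 0}"
    using v \<beta> by (auto simp: eigenspace_def A)
  have dim: "dim (eigenspace A \<alpha>) = CARD('n) - 1"
    unfolding hyperplane using dim_hyperplane[OF v] by simp
  have "spectrum A = {\<alpha>, \<gamma>}"
  proof (intro equalityI subsetI)
    fix c assume "c \<in> spectrum A"
    then obtain w where w: "w \<noteq> 0" "\<alpha> *\<^sub>R w + (\<beta> * (v \<bullet> w)) *\<^sub>R v = c *\<^sub>R w"
      by (auto simp: spectrum_def eigenspace_def A)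
    show "c \<in> {\<alpha>, \<gamma>}"
    proof (cases "v \<bullet> w = 0")
      case True
      then show ?thesis
        using w by auto
    next
      case False
      have "v \<bullet> (\<alpha> *\<^sub>R w + (\<beta> * (v \<bullet> w)) *\<^sub>R v) = v \<bullet> (c *\<^sub>R w)"
        using w(2) by simp
      then have "(\<alpha> + \<beta> * (v \<bullet> v)) * (v \<bullet> w) = c * (v \<bullet> w)"
        by (simp add: inner_add_right algebra_simps)
      then show ?thesis
        using False by (simp add: \<gamma>_def)
    qed
  next
    fix c assume "c \<in> {\<alpha>, \<gamma>}"
    moreover have "\<alpha> \<in> spectrum A"
    proof -
      have "\<not> eigenspace A \<alpha> \<subseteq> {0}"
        using dim N by (metis One_nat_def Suc_1 dim_eq_0 diff_is_0_eq not_less_eq_eq)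
      then show ?thesis
        by (auto simp: spectrum_def)
    qed
    moreover have "\<gamma> \<in> spectrum A"
      using v by (auto simp: spectrum_def eigenspace_def A \<gamma>_def algebra_simps intro!: exI[of _ v])
    ultimately show "c \<in> spectrum A"
      by auto
  qed
  moreover have "sorted_list_of_set {\<alpha>, \<gamma>} = [\<alpha>, \<gamma>]"
    using \<gamma> by (simp add: sorted_list_of_set_insert_remove insort_key_def)
  ultimately have "eigenvalue_list A = replicate (CARD('n) - 1) \<alpha> @ replicate (dim (eigenspace A \<gamma>)) \<gamma>"
    by (simp add: eigenvalue_list_def dim)
  moreover have "i - 1 < CARD('n) - 1"
    using i by auto
  ultimately show ?thesis
    by (simp add: eigenvalue_nth_def nth_append)
qed

section \<open>Derivatives of radial functions\<close>

text \<open>Writing the profile as a function of the squared distance keeps it differentiable at the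
  centre.\<close>

definition radial :: "(real \<Rightarrow> real) \<Rightarrow> 'a::real_inner \<Rightarrow> 'a \<Rightarrow> real" where
  "radial h c x = h ((x - c) \<bullet> (x - c))"

lemma radial_has_derivative:
  assumes h: "\<And>s. (h has_real_derivative h' s) (at s)"
  shows "(radial h c has_derivative (\<lambda>w. 2 * radial h' c x * ((x - c) \<bullet> w))) (at x)"
  unfolding radial_def
  by (rule has_derivative_eq_rhs,
      rule DERIV_compose_FDERIV[OF h], (rule derivative_eq_intros refl)+)
     (auto simp: fun_eq_iff inner_commute algebra_simps)

lemma gradient_radial:
  assumes h: "\<And>s. (h has_real_derivative h' s) (at s)"
  shows "gradient (radial h c) x = (2 * radial h' c x) *\<^sub>R (x - c)"
  by (simp add: gradient_def vec_eq_iff inner_axis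
      frechet_derivative_at[OF radial_has_derivative[OF h], symmetric])

lemma gradient_radial_has_derivative:
  fixes c :: "real^'n"
  assumes h: "\<And>s. (h has_real_derivative h' s) (at s)"
    and h': "\<And>s. (h' has_real_derivative h'' s) (at s)"
  shows "(gradient (radial h c) has_derivative
    (\<lambda>w. (2 * radial h' c x) *\<^sub>R w + (4 * radial h'' c x * ((x - c) \<bullet> w)) *\<^sub>R (x - c))) (at x)"
proof -
  have "((\<lambda>x. (2 * radial h' c x) *\<^sub>R (x - c)) has_derivative
    (\<lambda>w. (2 * radial h' c x) *\<^sub>R w + (4 * radial h'' c x * ((x - c) \<bullet> w)) *\<^sub>R (x - c))) (at x)"
    by (rule has_derivative_eq_rhs,
        (rule derivative_eq_intros radial_has_derivative[OF h'] refl)+)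
       (auto simp: fun_eq_iff algebra_simps)
  moreover have "gradient (radial h c) = (\<lambda>x. (2 * radial h' c x) *\<^sub>R (x - c))"
    by (intro ext gradient_radial h)
  ultimately show ?thesis
    by simp
qed

lemma hessian_radial_mult:
  fixes c :: "real^'n"
  assumes h: "\<And>s. (h has_real_derivative h' s) (at s)"
    and h': "\<And>s. (h' has_real_derivative h'' s) (at s)"
  shows "hessian (radial h c) x *v w =
    (2 * radial h' c x) *\<^sub>R w + (4 * radial h'' c x * ((x - c) \<bullet> w)) *\<^sub>R (x - c)"
proof -
  note D = gradient_radial_has_derivative[OF h h', where x = x and c = c]
  show ?thesis
    unfolding hessian_def jacobian_def frechet_derivative_at[OF D, symmetric]
    using has_derivative_linear[OF D] by (simp add: matrix_works linear_matrix_vector_mul_eq)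
qed

lemma C2_on_radial:
  fixes c :: "real^'n"
  assumes h: "\<And>s. (h has_real_derivative h' s) (at s)"
    and h': "\<And>s. (h' has_real_derivative h'' s) (at s)"
    and h'': "continuous_on UNIV h''"
  shows "C2_on \<Omega> (radial h c)"
proof -
  have "hessian (radial h c) x $ j $ k =
      2 * radial h' c x * axis k 1 $ j + 4 * radial h'' c x * (x - c) $ k * (x - c) $ j" for x j k
  proof -
    have "hessian (radial h c) x $ j $ k = (hessian (radial h c) x *v axis k 1) $ j"
      by (simp add: matrix_vector_mul_component inner_axis)
    then show ?thesis
      by (simp add: hessian_radial_mult[OF h h'] inner_axis)
  qed
  moreover have "continuous_on \<Omega> (\<lambda>x. radial h' c x)"
    using radial_has_derivative[OF h']
    by (intro has_derivative_continuous_on) (blast intro: has_derivative_at_withinI)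
  moreover have "continuous_on \<Omega> (\<lambda>x. radial h'' c x)"
    unfolding radial_def
    by (rule continuous_on_compose2[OF h'']) (auto intro!: continuous_intros)
  ultimately have "continuous_on \<Omega> (\<lambda>x. \<chi> j k. hessian (radial h c) x $ j $ k)"
    by (simp only:) (intro continuous_on_vec_lambda continuous_intros)
  then have "continuous_on \<Omega> (hessian (radial h c))"
    by simp
  then show ?thesis
    unfolding C2_on_def
    by (blast intro: differentiableI radial_has_derivative[OF h]
        gradient_radial_has_derivative[OF h h'])
qed

section \<open>Comparison on an annulus\<close>

text \<open>The eigenvalue \<open>t = 2 h'\<close> grows linearly and the gradient term like \<open>t\<^sup>p\<close> with \<open>p > 1\<close>, so a
  steep barrier is a strict supersolution. The threshold \<open>K\<close> serves all distances \<open>\<rho> \<ge> r\<close>; it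
  would degenerate at the centre of the ball, which is why the comparison runs on an annulus.\<close>

lemma strict_supersolution_slope:
  fixes p C r :: real
  assumes p: "p > 1" and r: "r > 0"
  obtains K where "K > 0" "\<And>t \<rho>. t \<ge> K \<Longrightarrow> \<rho> \<ge> r \<Longrightarrow> t < (t * \<rho>) powr p - C"
proof -
  have "eventually (\<lambda>t. t < (t * r) powr p - C) at_top"
    using p r by real_asymp
  then obtain K0 where K0: "\<And>t. t \<ge> K0 \<Longrightarrow> t < (t * r) powr p - C"
    by (auto simp: eventually_at_top_linorder)
  show ?thesis
  proof (rule that[of "max K0 1"])
    fix t \<rho> assume t: "t \<ge> max K0 1" and \<rho>: "\<rho> \<ge> r"
    then have "(t * r) powr p \<le> (t * \<rho>) powr p"
      using p r by (intro powr_mono2 mult_left_mono) auto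
    then show "t < (t * \<rho>) powr p - C"
      using K0[of t] t by auto
  qed simp
qed

text \<open>A profile that is convex and steep enough cannot touch a subsolution from above in the
  annulus, so the maximum of \<open>u - radial h y0\<close> over the closed annulus lies on its boundary.\<close>

lemma subsolution_le_radial_on_annulus:
  fixes \<Omega> :: "(real^'n) set"
  assumes sub: "viscosity_subsolution i p C \<Omega> u"
    and N: "CARD('n) \<ge> 2" and i: "i \<in> {1..CARD('n) - 1}"
    and r: "0 < r" and ball: "cball y0 \<rho> \<subseteq> \<Omega>"
    and h: "\<And>s. (h has_real_derivative h' s) (at s)"
    and h': "\<And>s. (h' has_real_derivative h'' s) (at s)"
    and h'': "continuous_on UNIV h''" "\<And>s. h'' s > 0"
    and steep: "\<And>s t. t \<ge> r \<Longrightarrow> 2 * h' s < (2 * h' s * t) powr p - C"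
    and h'_nonneg: "\<And>s. h' s \<ge> 0"
    and inner: "\<And>x. norm (x - y0) = r \<Longrightarrow> u x \<le> radial h y0 x"
    and outer: "\<And>x. norm (x - y0) = \<rho> \<Longrightarrow> u x \<le> radial h y0 x"
    and x: "r \<le> norm (x - y0)" "norm (x - y0) \<le> \<rho>"
  shows "u x \<le> radial h y0 x"
proof (rule ccontr)
  assume contra: "\<not> ?thesis"
  define S where "S = cball y0 \<rho> - ball y0 r"
  have S: "y \<in> S \<longleftrightarrow> r \<le> norm (y - y0) \<and> norm (y - y0) \<le> \<rho>" for y
    by (auto simp: S_def dist_norm norm_minus_commute)
  have "compact S"
    unfolding S_def by (intro compact_diff compact_cball open_ball)
  moreover have "x \<in> S"
    using x by (simp add: S)
  moreover have "(\<lambda>x. u x - radial h y0 x) \<in> USC S"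
  proof (rule USC_diff_continuous)
    show "u \<in> USC S"
      using sub ball by (auto simp: viscosity_subsolution_def S_def intro: USC_subset)
    show "continuous_on S (radial h y0)"
      using radial_has_derivative[OF h]
      by (intro has_derivative_continuous_on) (blast intro: has_derivative_at_withinI)
  qed
  ultimately obtain z where z: "z \<in> S"
      and zmax: "\<And>y. y \<in> S \<Longrightarrow> u y - radial h y0 y \<le> u z - radial h y0 z"
    using USC_attains_sup[of "\<lambda>x. u x - radial h y0 x" S] by blast
  have "u z > radial h y0 z"
    using zmax[OF \<open>x \<in> S\<close>] contra by simp
  then have interior: "r < norm (z - y0)" "norm (z - y0) < \<rho>"
    using z inner[of z] outer[of z] by (auto simp: S order.order_iff_strict)
  have "local_max_on \<Omega> (\<lambda>y. u y - radial h y0 y) z"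
  proof -
    have "open (ball y0 \<rho> - cball y0 r)"
      by (intro open_Diff open_ball closed_cball)
    moreover have "z \<in> ball y0 \<rho> - cball y0 r"
      using interior by (auto simp: dist_norm norm_minus_commute)
    moreover have "ball y0 \<rho> - cball y0 r \<subseteq> S"
      by (auto simp: S_def)
    ultimately show ?thesis
      using zmax ball z unfolding local_max_on_def eventually_at_topological S_def by blast
  qed
  then have "- eigenvalue_nth i (hessian (radial h y0) z) +
      norm (gradient (radial h y0) z) powr p \<le> C"
    using sub C2_on_radial[OF h h' h''(1)] by (auto simp: viscosity_subsolution_def)
  \<comment> \<open>The steep radial second derivative \<open>h''\<close> only enters the largest eigenvalue.\<close>
  moreover have "eigenvalue_nth i (hessian (radial h y0) z) = 2 * radial h' y0 z"
    by (rule eigenvalue_nth_rank_one_perturbation[OF hessian_radial_mult[OF h h'] _ _ N i])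
      (use interior r h''(2) in \<open>auto simp: radial_def\<close>)
  moreover have "norm (gradient (radial h y0) z) = 2 * radial h' y0 z * norm (z - y0)"
    using h'_nonneg by (simp add: gradient_radial[OF h] radial_def)
  ultimately show False
    using steep[of "norm (z - y0)" "(z - y0) \<bullet> (z - y0)"] interior by (simp add: radial_def)
qed

section \<open>Interior bound and absence of blow-up\<close>

text \<open>The bound uses no information on \<open>u\<close> near the boundary of the ball. Any bound \<open>a\<close> of \<open>u\<close> on a
  slightly smaller closed ball enters the barrier multiplied by an exponential that vanishes in
  the limit of large \<open>L\<close>.\<close>

lemma subsolution_bounded_above_on_ball:
  fixes \<Omega> :: "(real^'n) set"
  assumes sub: "viscosity_subsolution i p C \<Omega> u"
    and N: "CARD('n) \<ge> 2" and i: "i \<in> {1..CARD('n) - 1}" and p: "p > 1"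
    and R: "R > 0" and ball: "ball y0 R \<subseteq> \<Omega>"
  obtains B where "\<And>x. x \<in> ball y0 R \<Longrightarrow> u x \<le> B"
proof -
  have usc: "u \<in> USC \<Omega>"
    using sub by (simp add: viscosity_subsolution_def)
  have bdd: "\<exists>B. \<forall>x\<in>cball y0 \<rho>. u x \<le> B" if "\<rho> < R" for \<rho>
  proof -
    have "cball y0 \<rho> \<subseteq> \<Omega>"
      using ball that by (auto simp: subset_iff)
    then have "u \<in> USC (cball y0 \<rho>)"
      by (rule USC_subset[OF usc])
    then show ?thesis
      using compact_cball by (rule USC_bounded_above)
  qed
  define r where "r = R / 2"
  have r: "0 < r" "r < R"
    using R by (auto simp: r_def)
  obtain M0 where M0: "\<And>x. x \<in> cball y0 r \<Longrightarrow> u x \<le> M0"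
    using bdd[OF r(2)] by blast
  \<comment> \<open>With \<open>M \<ge> 0\<close> the other terms of the barrier are nonnegative on the outer sphere, where the
    exponential term alone dominates \<open>u\<close>.\<close>
  define M where "M = max M0 0"
  have M: "M \<ge> 0" "\<And>x. norm (x - y0) \<le> r \<Longrightarrow> u x \<le> M"
    using M0 by (auto simp: M_def dist_norm norm_minus_commute intro: le_max_iff_disj[THEN iffD2])
  obtain K where K: "K > 0" "\<And>t \<rho>. t \<ge> K \<Longrightarrow> \<rho> \<ge> r \<Longrightarrow> t < (t * \<rho>) powr p - C"
    using strict_supersolution_slope[OF p r(1)] by metis
  show ?thesis
  proof (rule that[of "M + K * R\<^sup>2"])
    fix x assume "x \<in> ball y0 R"
    then have xR: "norm (x - y0) < R"
      by (simp add: dist_norm norm_minus_commute)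
    show "u x \<le> M + K * R\<^sup>2"
    proof (cases "norm (x - y0) \<le> r")
      case True
      then show ?thesis
        using M(2)[of x] K(1) by (smt (verit) mult_nonneg_nonneg zero_le_power2)
    next
      case False
      define \<rho> where "\<rho> = (norm (x - y0) + R) / 2"
      have \<rho>: "norm (x - y0) < \<rho>" "\<rho> < R" "r < \<rho>"
        using xR False by (auto simp: \<rho>_def)
      obtain a0 where a0: "\<And>y. y \<in> cball y0 \<rho> \<Longrightarrow> u y \<le> a0"
        using bdd[OF \<rho>(2)] by blast
      \<comment> \<open>A positive \<open>a\<close> makes the profile strictly convex, so that \<open>2 h'\<close> is a strictly smaller
        eigenvalue than the radial one.\<close>
      define a where "a = max a0 1"
      have a: "a > 0" "\<And>y. norm (y - y0) \<le> \<rho> \<Longrightarrow> u y \<le> a"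
        using a0 by (auto simp: a_def dist_norm norm_minus_commute intro: le_max_iff_disj[THEN iffD2])
      define h where "h L s = M + K * (s - r\<^sup>2) + a * exp (L * (s - \<rho>\<^sup>2))" for L s
      have le: "u x \<le> h L ((norm (x - y0))\<^sup>2)" if L: "L > 0" for L
      proof -
        define h' where "h' s = K + a * L * exp (L * (s - \<rho>\<^sup>2))" for s
        define h'' where "h'' s = a * L\<^sup>2 * exp (L * (s - \<rho>\<^sup>2))" for s
        have "u x \<le> radial (h L) y0 x"
        proof (rule subsolution_le_radial_on_annulus[OF sub N i r(1)])
          show "cball y0 \<rho> \<subseteq> \<Omega>"
            using ball \<rho>(2) by (auto simp: subset_iff)
          show "(h L has_real_derivative h' s) (at s)" for s
            unfolding h_def[abs_def] h'_def by (auto intro!: derivative_eq_intros)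
          show "(h' has_real_derivative h'' s) (at s)" for s
            unfolding h'_def[abs_def] h''_def
            by (auto intro!: derivative_eq_intros simp: power2_eq_square)
          show "continuous_on UNIV h''"
            unfolding h''_def[abs_def] by (intro continuous_intros)
          show "h'' s > 0" for s
            using a(1) L by (simp add: h''_def)
          have slope: "h' s \<ge> K" for s
            using a(1) L by (simp add: h'_def)
          then show "h' s \<ge> 0" for s
            using K(1) by (meson less_eq_real_def order_trans)
          show "2 * h' s < (2 * h' s * t) powr p - C" if "t \<ge> r" for s t
            using K(2)[OF _ that, of "2 * h' s"] slope[of s] K(1) by simp
          show "u y \<le> radial (h L) y0 y" if "norm (y - y0) = r" for y
            using M(2)[of y] that a(1) by (simp add: radial_def h_def dot_square_norm add_increasing2)
          show "u y \<le> radial (h L) y0 y" if "norm (y - y0) = \<rho>" for y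
          proof -
            have "r\<^sup>2 \<le> \<rho>\<^sup>2"
              using r \<rho> by (intro power_mono) auto
            then show ?thesis
              using a(2)[of y] that M(1) K(1) by (simp add: radial_def h_def dot_square_norm add_increasing)
          qed
        qed (use False \<rho> in auto)
        then show ?thesis
          by (simp add: radial_def dot_square_norm)
      qed
      have "(norm (x - y0))\<^sup>2 - \<rho>\<^sup>2 < 0"
        using \<rho>(1) by (simp add: power_strict_mono)
      then have "((\<lambda>L. h L ((norm (x - y0))\<^sup>2)) \<longlongrightarrow> M + K * ((norm (x - y0))\<^sup>2 - r\<^sup>2)) at_top"
        unfolding h_def by real_asymp
      moreover have "eventually (\<lambda>L. u x \<le> h L ((norm (x - y0))\<^sup>2)) at_top"
        using eventually_gt_at_top[of 0] by eventually_elim (rule le)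
      ultimately have "u x \<le> M + K * ((norm (x - y0))\<^sup>2 - r\<^sup>2)"
        by (rule tendsto_lowerbound) simp
      also have "\<dots> \<le> M + K * R\<^sup>2"
      proof -
        have "(norm (x - y0))\<^sup>2 \<le> R\<^sup>2"
          using xR by (intro power_mono) auto
        then have "(norm (x - y0))\<^sup>2 - r\<^sup>2 \<le> R\<^sup>2"
          by (smt (verit) zero_le_power2)
        then show ?thesis
          using K(1) by (simp add: mult_left_mono)
      qed
      finally show ?thesis .
    qed
  qed
qed

theorem theorem1p1:
  fixes \<Omega> :: "(real^'n) set" and x0 :: "real^'n" and p C :: real and i :: nat
  assumes "CARD('n) \<ge> 2"
    and "p > 1"
    and "i \<in> {1..CARD('n) - 1}"
    and "open \<Omega>"
    and "interior_sphere_condition \<Omega> x0"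
  shows "\<not> (\<exists>u. u \<in> USC \<Omega> \<and> viscosity_subsolution i p C \<Omega> u \<and>
               filterlim u at_top (at x0 within \<Omega>))"
proof (safe)
  fix u assume sub: "viscosity_subsolution i p C \<Omega> u"
    and lim: "filterlim u at_top (at x0 within \<Omega>)"
  obtain y0 R where R: "R > 0" "ball y0 R \<subseteq> \<Omega>" "x0 \<in> frontier (ball y0 R)"
    using assms(5) by (auto simp: interior_sphere_condition_def)
  obtain B where B: "\<And>x. x \<in> ball y0 R \<Longrightarrow> u x \<le> B"
    using subsolution_bounded_above_on_ball[OF sub assms(1,3,2) R(1,2)] by blast
  \<comment> \<open>The limit at \<open>x0\<close> can be tested inside the ball, whose closure contains \<open>x0\<close>.\<close>
  have "x0 islimpt ball y0 R"
    using R by (simp add: islimpt_ball frontier_ball)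
  then have nontriv: "at x0 within ball y0 R \<noteq> bot"
    by (simp add: trivial_limit_within)
  have "filterlim u at_top (at x0 within ball y0 R)"
    using lim R(2) by (meson at_le filterlim_mono order_refl)
  then have "eventually (\<lambda>x. B < u x) (at x0 within ball y0 R)"
    by (simp add: filterlim_at_top_dense)
  moreover have "eventually (\<lambda>x. x \<in> ball y0 R) (at x0 within ball y0 R)"
    by (simp add: eventually_at_filter)
  ultimately have "eventually (\<lambda>x. False) (at x0 within ball y0 R)"
    by eventually_elim (use B in force)
  then show False
    using nontriv by (simp add: eventually_False)
qed

end
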